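(* Let $B:\{0,1\}^n\to\{0,1\}$ be a function computed by an oblivious, read-once, regular branching program of width $w$. Then for every $k\in\{1,\dots,n\}$, $$\sum_{s\in\{0,1\}^n:\,|s|=k}\left|\widehat B[s]\right|\le(2w^2)^k.$$
   Context: Write $[w]=\{1,\dots,w\}$. A length-$n$, width-$w$ program is a function $P:\{0,1\}^n\times[w]\to[w]$, written $P[x](u)$; it is identified with the matrix-valued function $x\mapsto P[x]\in\{0,1\}^{w\times w}$ where $P[x](u,v)=1$ iff $P[x](u)=v$. Concatenation of programs: $(P\circ P')[x\circ x']=P[x]\cdot P'[x']$ (matrix product). A length-$n$, width-$w$ ordered branching program is a program $P=P_1\circ\cdots\circ P_n$ with each layer $P_i$ a length-1, width-$w$ program. A (length-$n$, width-$w$) read-once, oblivious branching program is a function of the form $P[x]=P'[\pi(x)]$ where $P'$ is an ordered branching program, $\pi$ is a permutation of $[n]$, and the $i$-th bit of $\pi(x)$ is the $\pi(i)$-th bit of $x$. It is regular if, for every layer $P'_i$, the matrix $\mathbb{E}_{U}[P'_i[U]]$ ($U$ a uniform bit) is doubly stochastic. $P$ computes $f:\{0,1\}^n\to\{0,1\}$ if there are a start state $u_0\in[w]$ and a set of accept states $S\subset[w]$ such that $f(x)=1$ iff $P[x](u_0)\in S$. For $f:\{0,1\}^n\to\mathbb{R}$ and $s\in\{0,1\}^n$, $\widehat f[s]=\mathbb{E}_U[f(U)(-1)^{s\cdot U}]$ with $U$ uniform on $\{0,1\}^n$; $|s|$ is the Hamming weight of $s$. *)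

theory Defs
  imports
    "HOL-Analysis.Analysis"
    "HOL-Probability.Probability"
    "HOL-Combinatorics.Permutations"
begin

definition bitstrings :: "nat \<Rightarrow> bool list set" where
  "bitstrings n = {x. length x = n}"

text \<open>Expectation over a uniform element of the cube; also used for matrix-valued functions.\<close>
definition expect :: "nat \<Rightarrow> (bool list \<Rightarrow> 'b::{banach, second_countable_topology}) \<Rightarrow> 'b" where
  "expect n f = measure_pmf.expectation (pmf_of_set (bitstrings n)) f"

text \<open>The state set \<open>[w]\<close> is a finite type \<open>'w\<close> with \<open>w = CARD('w)\<close>. A length-\<open>n\<close> program
  is only relevant at arguments in \<open>bitstrings n\<close>; its values elsewhere are junk.\<close>
type_synonym 'w program = "bool list \<Rightarrow> 'w \<Rightarrow> 'w"

definition program_matrix :: "'w::finite program \<Rightarrow> bool list \<Rightarrow> real ^ 'w ^ 'w" where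
  "program_matrix P x = (\<chi> u v. if P x u = v then 1 else 0)"

text \<open>Concatenation, where the left factor has length \<open>m\<close>. The lemma below shows that this is the
  matrix product, with the left factor applied first.\<close>
definition program_concat :: "nat \<Rightarrow> 'w program \<Rightarrow> 'w program \<Rightarrow> 'w program" where
  "program_concat m P Q = (\<lambda>x u. Q (drop m x) (P (take m x) u))"

lemma program_matrix_concat:
  fixes P Q :: "'w::finite program"
  assumes "x \<in> bitstrings m"
  shows "program_matrix (program_concat m P Q) (x @ y) = program_matrix P x ** program_matrix Q y"
proof -
  have "(if Q y (P x u) = v then 1 else 0) =
    (\<Sum>t\<in>UNIV. (if P x u = t then 1 else 0) * (if Q y t = v then 1 else (0::real)))" for u v
    by (simp add: if_distrib[of "\<lambda>a. a * _"] cong: if_cong)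
  then show ?thesis
    using assms
    by (simp add: bitstrings_def program_matrix_def program_concat_def matrix_matrix_mult_def
        vec_eq_iff)
qed

text \<open>The ordered branching program whose layers are the given length-1 programs.\<close>
fun ordered_bp :: "'w program list \<Rightarrow> 'w program" where
  "ordered_bp [] = (\<lambda>x u. u)"
| "ordered_bp (L # Ls) = program_concat 1 L (ordered_bp Ls)"

definition permute_bits :: "(nat \<Rightarrow> nat) \<Rightarrow> bool list \<Rightarrow> bool list" where
  "permute_bits \<pi> x = map (\<lambda>i. x ! \<pi> i) [0..<length x]"

definition read_once_oblivious_bp ::
    "nat \<Rightarrow> 'w program list \<Rightarrow> (nat \<Rightarrow> nat) \<Rightarrow> 'w program \<Rightarrow> bool" where
  "read_once_oblivious_bp n Ls \<pi> P \<longleftrightarrow>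
    length Ls = n \<and> \<pi> permutes {..<n} \<and>
    (\<forall>x\<in>bitstrings n. P x = ordered_bp Ls (permute_bits \<pi> x))"

definition doubly_stochastic :: "real ^ 'w ^ 'w::finite \<Rightarrow> bool" where
  "doubly_stochastic M \<longleftrightarrow>
    (\<forall>u v. 0 \<le> M $ u $ v) \<and> (\<forall>u. (\<Sum>v\<in>UNIV. M $ u $ v) = 1) \<and> (\<forall>v. (\<Sum>u\<in>UNIV. M $ u $ v) = 1)"

definition regular_read_once_oblivious_bp :: "nat \<Rightarrow> 'w::finite program \<Rightarrow> bool" where
  "regular_read_once_oblivious_bp n P \<longleftrightarrow>
    (\<exists>Ls \<pi>. read_once_oblivious_bp n Ls \<pi> P \<and>
      (\<forall>L\<in>set Ls. doubly_stochastic (expect 1 (program_matrix L))))"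

definition computes :: "nat \<Rightarrow> 'w program \<Rightarrow> (bool list \<Rightarrow> bool) \<Rightarrow> bool" where
  "computes n P f \<longleftrightarrow> (\<exists>u\<^sub>0 S. \<forall>x\<in>bitstrings n. f x \<longleftrightarrow> P x u\<^sub>0 \<in> S)"

definition bits_inner :: "bool list \<Rightarrow> bool list \<Rightarrow> nat" where
  "bits_inner s x = (\<Sum>i<length s. of_bool (s ! i) * of_bool (x ! i))"

definition fourier :: "nat \<Rightarrow> (bool list \<Rightarrow> real) \<Rightarrow> bool list \<Rightarrow> real" where
  "fourier n f s = expect n (\<lambda>x. f x * (-1) ^ bits_inner s x)"

definition hamming_weight :: "bool list \<Rightarrow> nat" where
  "hamming_weight s = count_list s True"

end

theory Submission
  imports Defs
begin

text \<open>
  Expanding one layer at a time, the Fourier coefficient of \<open>x \<mapsto> y (P[x](u))\<close> at \<open>s\<close> is obtained by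
  applying to \<open>y\<close> an averaging operator for every \<open>0\<close> of \<open>s\<close> and a differencing operator for every
  \<open>1\<close> of \<open>s\<close>, the last layer first. For a regular layer the energy \<open>\<Sum>u v. \<bar>y u - y v\<bar>\<close> drops under
  averaging by at least the 1-norm of the difference, while the energy of the difference is at most
  \<open>2 w\<close> times that norm. Peeling off the last layer, the coefficients of weight \<open>k + 1\<close> therefore
  sum to at most \<open>(2 w)\<^sup>k\<close> times the energy of \<open>y\<close>, and an indicator function has energy at most \<open>w\<^sup>2\<close>.
\<close>

section \<open>Bit strings\<close>

abbreviation weight_class :: "nat \<Rightarrow> nat \<Rightarrow> bool list set" where
  "weight_class n k \<equiv> {s \<in> bitstrings n. hamming_weight s = k}"

lemma bitstrings_0 [simp]: "bitstrings 0 = {[]}"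
  by (auto simp: bitstrings_def)

lemma length_bitstring: "s \<in> bitstrings n \<Longrightarrow> length s = n"
  by (simp add: bitstrings_def)

lemma bitstrings_Suc:
  "bitstrings (Suc n) = Cons False ` bitstrings n \<union> Cons True ` bitstrings n"
  by (auto simp: bitstrings_def length_Suc_conv image_iff)

lemma finite_bitstrings [simp]: "finite (bitstrings n)"
  by (induction n) (auto simp: bitstrings_Suc)

lemma sum_bitstrings_Suc:
  "(\<Sum>x\<in>bitstrings (Suc n). f x) =
    (\<Sum>x\<in>bitstrings n. f (False # x)) + (\<Sum>x\<in>bitstrings n. f (True # x))"
  unfolding bitstrings_Suc
  by (subst sum.union_disjoint) (auto simp: sum.reindex inj_on_def)

lemma card_bitstrings [simp]: "card (bitstrings n) = 2 ^ n"
proof (induction n)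
  case (Suc n)
  then show ?case
    using sum_bitstrings_Suc[of "\<lambda>_. 1::nat" n] by simp
qed simp

text \<open>Scalar division lets the formula serve both real functions and the matrix-valued ones in
  the regularity condition.\<close>

lemma expect_eq:
  "expect n f = (\<Sum>x\<in>bitstrings n. f x /\<^sub>R 2 ^ n)"
proof -
  have ne: "bitstrings n \<noteq> {}"
    using card_bitstrings[of n] by fastforce
  show ?thesis
    unfolding expect_def
    by (subst integral_measure_pmf[where A = "bitstrings n"])
      (auto simp: ne divide_inverse intro!: sum.cong)
qed

lemma expect_Suc_real:
  fixes f :: "bool list \<Rightarrow> real"
  shows "expect (Suc n) f =
    (expect n (\<lambda>x. f (False # x)) + expect n (\<lambda>x. f (True # x))) / 2"
  by (simp add: expect_eq sum_bitstrings_Suc field_simps flip: sum_divide_distrib)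

lemma bits_inner_Cons:
  "bits_inner (b # s) (c # x) = of_bool (b \<and> c) + bits_inner s x"
  by (simp add: bits_inner_def sum.lessThan_Suc_shift del: sum.lessThan_Suc)

lemma weight_class_0: "weight_class 0 k = (if k = 0 then {[]} else {})"
  by (auto simp: hamming_weight_def)

text \<open>Strings are split at the last bit, unlike in \<open>bitstrings_Suc\<close>, because the
  energy argument peels off the last layer.\<close>

lemma weight_class_Suc_0: "weight_class (Suc n) 0 = (\<lambda>s. s @ [False]) ` weight_class n 0"
proof (intro equalityI subsetI)
  fix s assume "s \<in> weight_class (Suc n) 0"
  then show "s \<in> (\<lambda>s. s @ [False]) ` weight_class n 0"
    by (cases s rule: rev_cases)
      (auto simp: bitstrings_def hamming_weight_def image_iff split: if_splits)
qed (auto simp: bitstrings_def hamming_weight_def)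

lemma weight_class_Suc_Suc:
  "weight_class (Suc n) (Suc k) =
    (\<lambda>s. s @ [False]) ` weight_class n (Suc k) \<union> (\<lambda>s. s @ [True]) ` weight_class n k"
proof (intro equalityI subsetI)
  fix s assume "s \<in> weight_class (Suc n) (Suc k)"
  then show "s \<in> (\<lambda>s. s @ [False]) ` weight_class n (Suc k) \<union>
      (\<lambda>s. s @ [True]) ` weight_class n k"
    by (cases s rule: rev_cases)
      (auto simp: bitstrings_def hamming_weight_def image_iff split: if_splits)
qed (auto simp: bitstrings_def hamming_weight_def)

lemma sum_weight_class_Suc_0:
  "(\<Sum>s\<in>weight_class (Suc n) 0. f s) = (\<Sum>s\<in>weight_class n 0. f (s @ [False]))"
  unfolding weight_class_Suc_0 by (subst sum.reindex) (auto simp: inj_on_def)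

lemma sum_weight_class_Suc_Suc:
  "(\<Sum>s\<in>weight_class (Suc n) (Suc k). f s) =
    (\<Sum>s\<in>weight_class n (Suc k). f (s @ [False])) + (\<Sum>s\<in>weight_class n k. f (s @ [True]))"
  unfolding weight_class_Suc_Suc
  by (subst sum.union_disjoint) (auto simp: sum.reindex inj_on_def)

section \<open>The layer operators\<close>

text \<open>For fixed \<open>u\<close> this is the Fourier coefficient at \<open>b\<close> of the
  one-bit function sending \<open>c\<close> to \<open>y (L [c] u)\<close>.\<close>

definition layer_op :: "'w program \<Rightarrow> bool \<Rightarrow> ('w \<Rightarrow> real) \<Rightarrow> 'w \<Rightarrow> real" where
  "layer_op L b y u = (y (L [False] u) + (-1) ^ of_bool b * y (L [True] u)) / 2"

definition layers_op :: "'w program list \<Rightarrow> bool list \<Rightarrow> ('w \<Rightarrow> real) \<Rightarrow> 'w \<Rightarrow> real" where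
  "layers_op Ls s y = foldr (\<lambda>(L, b). layer_op L b) (zip Ls s) y"

lemma layers_op_Nil [simp]: "layers_op [] s y = y"
  by (simp add: layers_op_def)

lemma layers_op_Cons [simp]:
  "layers_op (L # Ls) (b # s) y = layer_op L b (layers_op Ls s y)"
  by (simp add: layers_op_def)

lemma layers_op_snoc:
  "length s = length Ls \<Longrightarrow>
    layers_op (Ls @ [L]) (s @ [b]) y = layers_op Ls s (layer_op L b y)"
  by (simp add: layers_op_def)

text \<open>Condition on the first input bit \<open>c\<close>: it moves the start state to
  \<open>L [c] u\<close>, so \<open>u\<close> is generalised, and a True bit contributes the sign
  \<open>(-1) ^ of_bool b\<close>.\<close>

lemma fourier_ordered_bp:
  "length s = length Ls \<Longrightarrow>
    fourier (length Ls) (\<lambda>x. y (ordered_bp Ls x u)) s = layers_op Ls s y u"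
proof (induction Ls arbitrary: s u)
  case Nil
  then show ?case
    by (simp add: fourier_def expect_eq bits_inner_def)
next
  case (Cons L Ls)
  then obtain b t where s: "s = b # t" and t: "length t = length Ls"
    by (cases s) auto
  have scale: "expect n (\<lambda>x. f x * (c * g x)) = c * expect n (\<lambda>x. f x * g x)"
    for n and c :: real and f g
    by (simp add: expect_eq sum_distrib_left mult_ac)
  have "fourier (Suc (length Ls)) (\<lambda>x. y (ordered_bp (L # Ls) x u)) s =
      (fourier (length Ls) (\<lambda>x. y (ordered_bp Ls x (L [False] u))) t +
        (-1) ^ of_bool b * fourier (length Ls) (\<lambda>x. y (ordered_bp Ls x (L [True] u))) t) / 2"
    unfolding fourier_def
    by (subst expect_Suc_real) (simp add: s program_concat_def bits_inner_Cons power_add scale)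
  then show ?case
    by (simp add: Cons.IH[OF t] s layer_op_def)
qed

section \<open>The energy argument\<close>

definition energy :: "('w::finite \<Rightarrow> real) \<Rightarrow> real" where
  "energy y = (\<Sum>u\<in>UNIV. \<Sum>v\<in>UNIV. \<bar>y u - y v\<bar>)"

lemma energy_nonneg: "0 \<le> energy y"
  by (simp add: energy_def sum_nonneg)

lemma energy_le_norm1:
  fixes y :: "'w::finite \<Rightarrow> real"
  shows "energy y \<le> 2 * real CARD('w) * (\<Sum>u\<in>UNIV. \<bar>y u\<bar>)"
proof -
  have "energy y \<le> (\<Sum>u\<in>UNIV. \<Sum>v\<in>UNIV. \<bar>y u\<bar> + \<bar>y v\<bar>)"
    unfolding energy_def by (intro sum_mono abs_triangle_ineq4)
  also have "\<dots> = 2 * real CARD('w) * (\<Sum>u\<in>UNIV. \<bar>y u\<bar>)"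
    by (simp add: sum.distrib sum_distrib_left mult_ac)
  finally show ?thesis .
qed

lemma regular_layer_sum:
  fixes L :: "'w::finite program" and g :: "'w \<Rightarrow> real"
  assumes "doubly_stochastic (expect 1 (program_matrix L))"
  shows "(\<Sum>u\<in>UNIV. g (L [False] u) + g (L [True] u)) = 2 * (\<Sum>u\<in>UNIV. g u)"
proof -
  have col: "(\<Sum>u\<in>UNIV. of_bool (L [False] u = v) + of_bool (L [True] u = v)) = (2::real)" for v
  proof -
    have entry: "expect 1 (program_matrix L) $ u $ v =
        (of_bool (L [False] u = v) + of_bool (L [True] u = v)) / 2" for u
      using sum_bitstrings_Suc[of "\<lambda>x. program_matrix L x /\<^sub>R 2" 0]
      by (simp add: expect_eq program_matrix_def of_bool_def)
    have "(\<Sum>u\<in>UNIV. expect 1 (program_matrix L) $ u $ v) = 1"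
      using assms unfolding doubly_stochastic_def by blast
    then show ?thesis
      unfolding entry by (simp flip: sum_divide_distrib)
  qed
  have point: "g a = (\<Sum>v\<in>UNIV. g v * of_bool (a = v))" for a
    by (simp add: of_bool_def if_distrib cong: if_cong)
  have "(\<Sum>u\<in>UNIV. g (L [False] u) + g (L [True] u)) =
      (\<Sum>u\<in>UNIV. \<Sum>v\<in>UNIV. g v * (of_bool (L [False] u = v) + of_bool (L [True] u = v)))"
    by (simp only: point[of "L b u" for b u] sum.distrib distrib_left)
  also have "\<dots> = (\<Sum>v\<in>UNIV. g v * (\<Sum>u\<in>UNIV. of_bool (L [False] u = v) + of_bool (L [True] u = v)))"
    by (subst sum.swap) (simp only: sum_distrib_left)
  finally show ?thesis
    by (simp only: col mult.commute flip: sum_distrib_right)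
qed

text \<open>
  By regularity, the distances between all pairs of edges leaving \<open>u\<close> and \<open>v\<close> sum to four times the
  energy; the triangle inequality handles \<open>u \<noteq> v\<close>, and the diagonal yields the gain.
\<close>
lemma energy_drop:
  fixes L :: "'w::finite program"
  assumes "doubly_stochastic (expect 1 (program_matrix L))"
  shows "energy (layer_op L False y) + (\<Sum>u\<in>UNIV. \<bar>layer_op L True y u\<bar>) \<le> energy y"
proof -
  define a c where "a u = y (L [False] u)" and "c u = y (L [True] u)" for u
  note reg = regular_layer_sum[OF assms]
  have inner: "(\<Sum>v\<in>UNIV. \<bar>r - a v\<bar> + \<bar>r - c v\<bar>) = 2 * (\<Sum>v\<in>UNIV. \<bar>r - y v\<bar>)" for r
    unfolding a_def c_def by (rule reg)
  have "4 * (energy (layer_op L False y) + (\<Sum>u\<in>UNIV. \<bar>layer_op L True y u\<bar>)) =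
      (\<Sum>u\<in>UNIV. \<Sum>v\<in>UNIV. 4 * \<bar>layer_op L False y u - layer_op L False y v\<bar> +
        (if v = u then 4 * \<bar>layer_op L True y u\<bar> else 0))"
    by (simp add: energy_def sum.distrib flip: sum_distrib_left)
  also have "\<dots> \<le> (\<Sum>u\<in>UNIV. \<Sum>v\<in>UNIV.
      (\<bar>a u - a v\<bar> + \<bar>a u - c v\<bar>) + (\<bar>c u - a v\<bar> + \<bar>c u - c v\<bar>))"
    unfolding layer_op_def a_def[symmetric] c_def[symmetric]
    by (intro sum_mono) (auto simp: abs_if field_simps)
  also have "\<dots> = (\<Sum>u\<in>UNIV. 2 * (\<Sum>v\<in>UNIV. \<bar>a u - y v\<bar>) + 2 * (\<Sum>v\<in>UNIV. \<bar>c u - y v\<bar>))"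
    by (simp only: inner sum.distrib[where h = "\<lambda>v. \<bar>_ - a v\<bar> + \<bar>_ - c v\<bar>"])
  also have "\<dots> = 4 * energy y"
    using reg[of "\<lambda>r. 2 * (\<Sum>v\<in>UNIV. \<bar>y r - y v\<bar>)"]
    unfolding a_def c_def energy_def by (simp flip: sum_distrib_left)
  finally show ?thesis
    by simp
qed

lemma layers_op_weight_0:
  fixes y :: "'w \<Rightarrow> real"
  assumes "\<And>v. \<bar>y v\<bar> \<le> M"
  shows "(\<Sum>s\<in>weight_class (length Ls) 0. \<bar>layers_op Ls s y u\<bar>) \<le> M"
  using assms
proof (induction Ls arbitrary: y rule: rev_induct)
  case Nil
  then show ?case
    unfolding list.size weight_class_0 by simp
next
  case (snoc L Ls)
  have "\<bar>layer_op L False y v\<bar> \<le> M" for v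
    using snoc.prems[of "L [False] v"] snoc.prems[of "L [True] v"]
    by (simp add: layer_op_def)
  from snoc.IH[OF this] show ?case
    by (simp add: sum_weight_class_Suc_0 layers_op_snoc length_bitstring)
qed

lemma layers_op_weight_Suc:
  fixes y :: "'w::finite \<Rightarrow> real"
  assumes "\<forall>L\<in>set Ls. doubly_stochastic (expect 1 (program_matrix L))"
  shows "(\<Sum>s\<in>weight_class (length Ls) (Suc k). \<bar>layers_op Ls s y u\<bar>) \<le>
    (2 * real CARD('w)) ^ k * energy y"
  using assms
proof (induction Ls arbitrary: y k rule: rev_induct)
  case Nil
  then show ?case
    unfolding list.size weight_class_0 by (simp add: energy_nonneg)
next
  case (snoc L Ls)
  let ?C = "2 * real CARD('w)" and ?D = "\<Sum>u\<in>UNIV. \<bar>layer_op L True y u\<bar>"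
  have IH: "(\<Sum>s\<in>weight_class (length Ls) (Suc j). \<bar>layers_op Ls s z u\<bar>) \<le> ?C ^ j * energy z"
    for j z
    using snoc by auto
  have diff: "(\<Sum>s\<in>weight_class (length Ls) k. \<bar>layers_op Ls s (layer_op L True y) u\<bar>) \<le> ?C ^ k * ?D"
  proof (cases k)
    case 0
    have "\<bar>layer_op L True y v\<bar> \<le> ?D" for v
      by (rule member_le_sum) auto
    then show ?thesis
      unfolding 0 by (simp add: layers_op_weight_0)
  next
    case (Suc j)
    have "?C ^ j * energy (layer_op L True y) \<le> ?C ^ j * (?C * ?D)"
      by (intro mult_left_mono energy_le_norm1) simp
    with IH[where j = j and z = "layer_op L True y"] show ?thesis
      unfolding Suc power_Suc2 mult.assoc by (rule order_trans)
  qed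
  have "(\<Sum>s\<in>weight_class (length (Ls @ [L])) (Suc k). \<bar>layers_op (Ls @ [L]) s y u\<bar>) =
      (\<Sum>s\<in>weight_class (length Ls) (Suc k). \<bar>layers_op Ls s (layer_op L False y) u\<bar>) +
      (\<Sum>s\<in>weight_class (length Ls) k. \<bar>layers_op Ls s (layer_op L True y) u\<bar>)"
    by (simp add: sum_weight_class_Suc_Suc layers_op_snoc length_bitstring)
  also have "\<dots> \<le> ?C ^ k * energy (layer_op L False y) + ?C ^ k * ?D"
    by (intro add_mono IH diff)
  also have "\<dots> = ?C ^ k * (energy (layer_op L False y) + ?D)"
    by (simp add: distrib_left)
  also have "\<dots> \<le> ?C ^ k * energy y"
    using snoc.prems by (intro mult_left_mono energy_drop) auto
  finally show ?case .
qed

section \<open>Permuting the input bits\<close>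

lemma permute_bits_bij:
  assumes "\<pi> permutes {..<n}"
  shows "bij_betw (permute_bits \<pi>) (bitstrings n) (bitstrings n)"
proof (rule bij_betw_byWitness[where f' = "permute_bits (inv \<pi>)"])
  have range: "\<pi> i < n \<longleftrightarrow> i < n" "inv \<pi> i < n \<longleftrightarrow> i < n" for i
    using permutes_in_image[OF assms] permutes_in_image[OF permutes_inv[OF assms]] by auto
  show "\<forall>x\<in>bitstrings n. permute_bits (inv \<pi>) (permute_bits \<pi> x) = x"
    and "\<forall>x\<in>bitstrings n. permute_bits \<pi> (permute_bits (inv \<pi>) x) = x"
    by (intro ballI nth_equalityI;
        simp add: permute_bits_def bitstrings_def range permutes_inverses[OF assms])+
qed (auto simp: permute_bits_def bitstrings_def)

lemma bits_inner_permute: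
  assumes "\<pi> permutes {..<n}" "s \<in> bitstrings n" "x \<in> bitstrings n"
  shows "bits_inner (permute_bits \<pi> s) (permute_bits \<pi> x) = bits_inner s x"
  using assms(2,3) sum.permute[OF assms(1), of "\<lambda>i. of_bool (s ! i) * of_bool (x ! i) :: nat"]
  by (simp add: bits_inner_def permute_bits_def bitstrings_def o_def
      del: sum_of_bool_mult_eq sum_mult_of_bool_eq)

lemma hamming_weight_permute:
  assumes "\<pi> permutes {..<n}" "s \<in> bitstrings n"
  shows "hamming_weight (permute_bits \<pi> s) = hamming_weight s"
proof -
  have "hamming_weight t = bits_inner t t" for t
  proof (induction t)
    case Nil
    then show ?case by (simp add: hamming_weight_def bits_inner_def)
  next
    case (Cons b t)
    then show ?case by (simp add: hamming_weight_def bits_inner_Cons)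
  qed
  with bits_inner_permute[OF assms assms(2)] show ?thesis
    by simp
qed

lemma fourier_permute:
  assumes "\<pi> permutes {..<n}" "s \<in> bitstrings n"
  shows "fourier n (\<lambda>x. g (permute_bits \<pi> x)) s = fourier n g (permute_bits \<pi> s)"
proof -
  have "fourier n g (permute_bits \<pi> s) =
      (\<Sum>x\<in>bitstrings n. (g (permute_bits \<pi> x) *
        (-1) ^ bits_inner (permute_bits \<pi> s) (permute_bits \<pi> x)) /\<^sub>R 2 ^ n)"
    unfolding fourier_def expect_eq
    by (rule sum.reindex_bij_betw[OF permute_bits_bij[OF assms(1)], symmetric])
  also have "\<dots> = fourier n (\<lambda>x. g (permute_bits \<pi> x)) s"
    unfolding fourier_def expect_eq
    using assms by (intro sum.cong) (simp_all add: bits_inner_permute)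
  finally show ?thesis ..
qed

lemma sum_weight_class_permute:
  assumes "\<pi> permutes {..<n}"
  shows "(\<Sum>s\<in>weight_class n k. h (permute_bits \<pi> s)) = (\<Sum>s\<in>weight_class n k. h s)"
proof (rule sum.reindex_bij_betw)
  note bij = permute_bits_bij[OF assms]
  have "permute_bits \<pi> ` weight_class n k = weight_class n k"
  proof (intro equalityI subsetI)
    fix t assume t: "t \<in> weight_class n k"
    then obtain s where "s \<in> bitstrings n" "t = permute_bits \<pi> s"
      using bij by (auto simp: bij_betw_def)
    with t show "t \<in> permute_bits \<pi> ` weight_class n k"
      using hamming_weight_permute[OF assms] by auto
  qed (use bij hamming_weight_permute[OF assms] in \<open>auto simp: bij_betw_def\<close>)
  with bij show "bij_betw (permute_bits \<pi>) (weight_class n k) (weight_class n k)"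
    by (auto simp: bij_betw_def intro: inj_on_subset)
qed

theorem theorem1p4:
  fixes B :: "bool list \<Rightarrow> bool" and P :: "'w::finite program" and n k :: nat
  assumes "regular_read_once_oblivious_bp n P"
    and "computes n P B"
    and "k \<in> {1..n}"
  shows "(\<Sum>s\<in>{s \<in> bitstrings n. hamming_weight s = k}. \<bar>fourier n (\<lambda>x. of_bool (B x)) s\<bar>)
    \<le> (2 * (real CARD('w))\<^sup>2) ^ k"
proof -
  let ?w = "real CARD('w)"
  obtain Ls \<pi> where len: "length Ls = n" and \<pi>: "\<pi> permutes {..<n}"
    and P: "\<And>x. x \<in> bitstrings n \<Longrightarrow> P x = ordered_bp Ls (permute_bits \<pi> x)"
    and reg: "\<forall>L\<in>set Ls. doubly_stochastic (expect 1 (program_matrix L))"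
    using assms(1)
    unfolding regular_read_once_oblivious_bp_def read_once_oblivious_bp_def by blast
  obtain u0 S where B: "\<And>x. x \<in> bitstrings n \<Longrightarrow> B x \<longleftrightarrow> P x u0 \<in> S"
    using assms(2) unfolding computes_def by blast
  obtain j where k: "k = Suc j"
    using assms(3) by (cases k) auto
  define y :: "'w \<Rightarrow> real" where "y v = of_bool (v \<in> S)" for v
  have coeff: "fourier n (\<lambda>x. of_bool (B x)) s = layers_op Ls (permute_bits \<pi> s) y u0"
    if s: "s \<in> bitstrings n" for s
  proof -
    have "fourier n (\<lambda>x. of_bool (B x)) s =
        fourier n (\<lambda>x. y (ordered_bp Ls (permute_bits \<pi> x) u0)) s"
      by (simp add: fourier_def expect_eq B P y_def)
    also have "\<dots> = fourier n (\<lambda>x. y (ordered_bp Ls x u0)) (permute_bits \<pi> s)"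
      by (rule fourier_permute[OF \<pi> s])
    also have "\<dots> = layers_op Ls (permute_bits \<pi> s) y u0"
      using fourier_ordered_bp[of "permute_bits \<pi> s" Ls] s
      by (simp add: len bitstrings_def permute_bits_def)
    finally show ?thesis .
  qed
  have "(\<Sum>s\<in>weight_class n k. \<bar>fourier n (\<lambda>x. of_bool (B x)) s\<bar>) =
      (\<Sum>s\<in>weight_class n k. \<bar>layers_op Ls (permute_bits \<pi> s) y u0\<bar>)"
    by (simp add: coeff)
  also have "\<dots> = (\<Sum>s\<in>weight_class n k. \<bar>layers_op Ls s y u0\<bar>)"
    by (rule sum_weight_class_permute[OF \<pi>])
  also have "\<dots> \<le> (2 * ?w) ^ j * energy y"
    using layers_op_weight_Suc[OF reg, where k = j and y = y and u = u0] by (simp add: k len)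
  also have "\<dots> \<le> (2 * ?w\<^sup>2) ^ j * (2 * ?w\<^sup>2)"
  proof (rule mult_mono)
    have "1 \<le> ?w"
      by (simp add: Suc_leI)
    then have "2 * ?w \<le> 2 * ?w\<^sup>2"
      by (simp add: power2_eq_square)
    then show "(2 * ?w) ^ j \<le> (2 * ?w\<^sup>2) ^ j"
      by (rule power_mono) simp
    have "energy y \<le> (\<Sum>u\<in>(UNIV::'w set). \<Sum>v\<in>(UNIV::'w set). 1)"
      unfolding energy_def by (intro sum_mono) (simp add: y_def)
    also have "\<dots> \<le> 2 * ?w\<^sup>2"
      by (simp add: power2_eq_square)
    finally show "energy y \<le> 2 * ?w\<^sup>2" .
  qed (simp_all add: energy_nonneg)
  finally show ?thesis
    by (simp add: k mult.commute)
qed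

end
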